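(* For every $n>1$, there exists a $\Pi^0_2$ equivalence relation $E$ on $\omega$ which is complete under $\leq_c^n$ among $\Pi^0_2$ equivalence relations, but is not complete under $\leq_c^{n+1}$ among $\Pi^0_2$ equivalence relations.
   Context: For equivalence relations $E,F$ on $\omega$ and $n\ge1$, $F\leq_c^nE$ means there is a total computable function mapping each $(x_0,\dots,x_{n-1})\in\omega^n$ to $(y_0,\dots,y_{n-1})\in\omega^n$ with $x_i\,F\,x_j\iff y_i\,E\,y_j$ for all $i<j<n$. $E$ is complete under $\leq_c^n$ among $\Pi^0_2$ equivalence relations if $E$ is a $\Pi^0_2$ subset of $\omega\times\omega$ and every $\Pi^0_2$ equivalence relation $F$ on $\omega$ satisfies $F\leq_c^nE$. *)

theory Defs
  imports Main "HOL-Library.Nat_Bijection"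
begin

text \<open>Total (general) recursive functions, in unary form on natural numbers,
  with tuples coded by the Cantor pairing function prod_encode.
  This is Kleene's class: basic functions, closed under composition, pairing,
  primitive recursion and the mu-operator applied to regular functions.\<close>

definition prim_rec_op :: "(nat \<Rightarrow> nat) \<Rightarrow> (nat \<Rightarrow> nat) \<Rightarrow> nat \<Rightarrow> nat" where
  "prim_rec_op g h = (\<lambda>p. case prod_decode p of (x, m) \<Rightarrow>
      rec_nat (g x) (\<lambda>k r. h (prod_encode (x, prod_encode (k, r)))) m)"

inductive total_rec :: "(nat \<Rightarrow> nat) \<Rightarrow> bool" where
  zero_fn: "total_rec (\<lambda>_. 0)"
| succ_fn: "total_rec Suc"
| ident_fn: "total_rec (\<lambda>x. x)"
| fst_dec: "total_rec (\<lambda>p. fst (prod_decode p))"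
| snd_dec: "total_rec (\<lambda>p. snd (prod_decode p))"
| compose: "total_rec f \<Longrightarrow> total_rec g \<Longrightarrow> total_rec (\<lambda>x. f (g x))"
| pairing: "total_rec f \<Longrightarrow> total_rec g \<Longrightarrow> total_rec (\<lambda>x. prod_encode (f x, g x))"
| prim_rec: "total_rec g \<Longrightarrow> total_rec h \<Longrightarrow> total_rec (prim_rec_op g h)"
| minimize: "total_rec g \<Longrightarrow> (\<forall>x. \<exists>y. g (prod_encode (x, y)) = 0) \<Longrightarrow>
       total_rec (\<lambda>x. LEAST y. g (prod_encode (x, y)) = 0)"

definition computable_set :: "nat set \<Rightarrow> bool" where
  "computable_set A \<longleftrightarrow> total_rec (\<lambda>x. if x \<in> A then 1 else 0)"

definition Pi02 :: "(nat \<times> nat) set \<Rightarrow> bool" where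
  "Pi02 E \<longleftrightarrow> (\<exists>R. computable_set R \<and>
     (\<forall>x y. (x, y) \<in> E \<longleftrightarrow>
        (\<forall>u. \<exists>v. prod_encode (prod_encode (x, y), prod_encode (u, v)) \<in> R)))"

definition creducible_n :: "nat \<Rightarrow> (nat \<times> nat) set \<Rightarrow> (nat \<times> nat) set \<Rightarrow> bool" where
  "creducible_n n F E \<longleftrightarrow> (\<exists>f. total_rec f \<and>
     (\<forall>xs. length xs = n \<longrightarrow>
        (let ys = list_decode (f (list_encode xs)) in
          length ys = n \<and>
          (\<forall>i j. i < j \<and> j < n \<longrightarrow> ((xs ! i, xs ! j) \<in> F \<longleftrightarrow> (ys ! i, ys ! j) \<in> E)))))"

definition Pi02_complete_n :: "nat \<Rightarrow> (nat \<times> nat) set \<Rightarrow> bool" where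
  "Pi02_complete_n n E \<longleftrightarrow> Pi02 E \<and>
     (\<forall>F. equiv UNIV F \<and> Pi02 F \<longrightarrow> creducible_n n F E)"

end

theory Submission
  imports Defs
begin

text \<open>Take \<open>E\<close> to be a disjoint union of blocks with \<open>n\<close> elements each. The block with index
  \<open>\<langle>e, z\<rangle>\<close> carries the pattern that the \<open>e\<close>-th \<open>\<Pi>\<^sup>0\<^sub>2\<close> relation induces on the \<open>n\<close>-tuple \<open>z\<close>, forced
  into an equivalence relation in a uniformly \<open>\<Pi>\<^sup>0\<^sub>2\<close> way; hence an \<open>n\<close>-tuple reduces to its own block.
  On the other hand, if \<open>n + 1\<close> numbers lie in one block then two of them are trivially
  \<open>E\<close>-equivalent, and if they do not then two are trivially inequivalent. It is decidable which case
  occurs, so a recursively enumerable equivalence relation can diagonalise: it keeps the \<open>e\<close>-th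
  \<open>(n + 1)\<close>-tuple discrete until the \<open>e\<close>-th program maps it to numbers that do not lie in one block,
  and then collapses it.\<close>

section \<open>Closure properties of the recursive functions\<close>

abbreviation pfst :: "nat \<Rightarrow> nat" where "pfst p \<equiv> fst (prod_decode p)"
abbreviation psnd :: "nat \<Rightarrow> nat" where "psnd p \<equiv> snd (prod_decode p)"

definition decidable :: "(nat \<Rightarrow> bool) \<Rightarrow> bool" where
  "decidable P \<longleftrightarrow> computable_set {x. P x}"

lemma decidable_iff: "decidable P \<longleftrightarrow> total_rec (\<lambda>x. if P x then 1 else 0)"
  by (simp add: decidable_def computable_set_def)

lemma total_rec_cong: "total_rec f \<Longrightarrow> (\<And>x. f x = g x) \<Longrightarrow> total_rec g"
  by (metis ext)

lemma decidable_cong: "decidable P \<Longrightarrow> (\<And>x. P x \<longleftrightarrow> Q x) \<Longrightarrow> decidable Q"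
  by (erule back_subst[where P = decidable]) auto

lemma total_rec_Suc: "total_rec f \<Longrightarrow> total_rec (\<lambda>x. Suc (f x))"
  by (rule compose[OF succ_fn])

lemma total_rec_pfst: "total_rec f \<Longrightarrow> total_rec (\<lambda>x. pfst (f x))"
  by (rule compose[OF fst_dec])

lemma total_rec_psnd: "total_rec f \<Longrightarrow> total_rec (\<lambda>x. psnd (f x))"
  by (rule compose[OF snd_dec])

lemma total_rec_const: "total_rec (\<lambda>_. c)"
  by (induction c) (auto intro: zero_fn total_rec_Suc)

text \<open>\<open>prim_rec_op\<close> with its coded arguments unpacked; case distinction,
  truncated subtraction and bounded search are all obtained as recursions of this form.\<close>

lemma total_rec_rec_nat:
  assumes "total_rec g" and h: "total_rec (\<lambda>q. h (pfst q) (pfst (psnd q)) (psnd (psnd q)))"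
    and m: "total_rec m"
  shows "total_rec (\<lambda>x. rec_nat (g x) (\<lambda>k r. h x k r) (m x))"
proof -
  have "total_rec (\<lambda>x. prim_rec_op g (\<lambda>q. h (pfst q) (pfst (psnd q)) (psnd (psnd q)))
          (prod_encode (x, m x)))"
    by (intro compose[OF prim_rec] assms pairing ident_fn)
  then show ?thesis
    by (simp add: prim_rec_op_def)
qed

lemmas total_rec_basic = ident_fn total_rec_const total_rec_Suc total_rec_pfst total_rec_psnd pairing

lemma total_rec_if:
  assumes P: "decidable P" and f: "total_rec f" and g: "total_rec g"
  shows "total_rec (\<lambda>x. if P x then f x else g x)"
proof -
  have "total_rec (\<lambda>x. rec_nat (g x) (\<lambda>k r. f x) (if P x then 1 else 0))"
    by (intro total_rec_rec_nat g P[unfolded decidable_iff] compose[OF f] total_rec_basic)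
  moreover have "(\<lambda>x. rec_nat (g x) (\<lambda>k r. f x) (if P x then 1 else 0)) = (\<lambda>x. if P x then f x else g x)"
    by auto
  ultimately show ?thesis by simp
qed

lemma total_rec_pred:
  assumes "total_rec f"
  shows "total_rec (\<lambda>x. f x - 1)"
proof -
  have "total_rec (\<lambda>x. rec_nat 0 (\<lambda>k r. k) (f x))"
    by (intro total_rec_rec_nat total_rec_basic assms)
  moreover have "rec_nat 0 (\<lambda>k r. k) m = m - 1" for m :: nat
    by (cases m) auto
  ultimately show ?thesis by simp
qed

lemma total_rec_diff:
  assumes "total_rec f" "total_rec g"
  shows "total_rec (\<lambda>x. f x - g x)"
proof -
  have "total_rec (\<lambda>x. rec_nat (f x) (\<lambda>k r. r - 1) (g x))"
    by (intro total_rec_rec_nat total_rec_pred total_rec_basic assms)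
  moreover have "rec_nat a (\<lambda>k r. r - 1) m = a - m" for a m :: nat
    by (induction m) auto
  ultimately show ?thesis by simp
qed

section \<open>Decidable predicates\<close>

lemma decidable_compose: "decidable P \<Longrightarrow> total_rec f \<Longrightarrow> decidable (\<lambda>x. P (f x))"
  unfolding decidable_iff by (rule compose)

lemma decidable_zero: "decidable (\<lambda>x. x = 0)"
proof -
  have "total_rec (\<lambda>x. rec_nat 1 (\<lambda>k r. 0) x)"
    by (intro total_rec_rec_nat total_rec_basic)
  moreover have "rec_nat 1 (\<lambda>k r. 0) m = (if m = 0 then 1 else 0)" for m :: nat
    by (cases m) auto
  ultimately show ?thesis unfolding decidable_iff by (rule total_rec_cong)
qed

lemma decidable_const: "decidable (\<lambda>_. b)"
  unfolding decidable_iff by (rule total_rec_const)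

lemma decidable_if:
  assumes "decidable P" "decidable Q" "decidable R"
  shows "decidable (\<lambda>x. if P x then Q x else R x)"
proof -
  have "total_rec (\<lambda>x. if P x then if Q x then 1 else 0 else if R x then 1 else 0)"
    using assms by (intro total_rec_if total_rec_const)
  then show ?thesis
    unfolding decidable_iff by (rule total_rec_cong) simp
qed

lemma decidable_not: "decidable P \<Longrightarrow> decidable (\<lambda>x. \<not> P x)"
  by (rule decidable_cong[OF decidable_if[of P "\<lambda>_. False" "\<lambda>_. True"]]) (auto intro: decidable_const)

lemma decidable_conj: "decidable P \<Longrightarrow> decidable Q \<Longrightarrow> decidable (\<lambda>x. P x \<and> Q x)"
  by (rule decidable_cong[OF decidable_if[of P Q "\<lambda>_. False"]]) (auto intro: decidable_const)

lemma decidable_disj: "decidable P \<Longrightarrow> decidable Q \<Longrightarrow> decidable (\<lambda>x. P x \<or> Q x)"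
  by (rule decidable_cong[OF decidable_if[of P "\<lambda>_. True" Q]]) (auto intro: decidable_const)

lemma decidable_iff_pred: "decidable P \<Longrightarrow> decidable Q \<Longrightarrow> decidable (\<lambda>x. P x \<longleftrightarrow> Q x)"
  by (rule decidable_cong[OF decidable_if[of P Q "\<lambda>x. \<not> Q x"]]) (auto intro: decidable_not)

lemma decidable_le:
  assumes "total_rec f" "total_rec g"
  shows "decidable (\<lambda>x. f x \<le> g x)"
  using decidable_compose[OF decidable_zero total_rec_diff[OF assms]] by simp

lemma decidable_less:
  assumes "total_rec f" "total_rec g"
  shows "decidable (\<lambda>x. f x < g x)"
  using decidable_not[OF decidable_le[OF assms(2,1)]] by (simp add: not_le)

lemma decidable_eq:
  assumes "total_rec f" "total_rec g"
  shows "decidable (\<lambda>x. f x = g x)"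
  using decidable_conj[OF decidable_le[OF assms] decidable_le[OF assms(2,1)]]
  by (simp add: eq_iff)

lemma decidable_bounded_ex:
  assumes P: "decidable (\<lambda>p. P (pfst p) (psnd p))" and b: "total_rec b"
  shows "decidable (\<lambda>x. \<exists>y<b x. P x y)"
proof -
  have "total_rec (\<lambda>x. rec_nat 0 (\<lambda>k r. if P x k then 1 else r) (b x))"
    using decidable_compose[OF P, of "\<lambda>q. prod_encode (pfst q, pfst (psnd q))"]
    by (intro total_rec_rec_nat total_rec_if total_rec_basic b) (simp add: total_rec_basic)
  moreover have "rec_nat 0 (\<lambda>k r. if P x k then 1 else r) m = (if \<exists>y<m. P x y then 1 else 0)"
    for x m :: nat
    by (induction m) (auto simp: less_Suc_eq)
  ultimately show ?thesis unfolding decidable_iff by (rule total_rec_cong)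
qed

lemma decidable_bounded_all:
  assumes P: "decidable (\<lambda>p. P (pfst p) (psnd p))" and b: "total_rec b"
  shows "decidable (\<lambda>x. \<forall>y<b x. P x y)"
  using decidable_not[OF decidable_bounded_ex[OF decidable_not[OF P] b]] by simp

text \<open>Meant for quantifiers written without a bound, such as those over intermediate values in
  the evaluation rules.\<close>

lemma decidable_ex_bounded:
  assumes P: "decidable (\<lambda>p. P (pfst p) (psnd p))" and b: "total_rec b"
    and bound: "\<And>x y. P x y \<Longrightarrow> y < b x"
  shows "decidable (\<lambda>x. \<exists>y. P x y)"
proof -
  have "(\<lambda>x. \<exists>y. P x y) = (\<lambda>x. \<exists>y<b x. P x y)"
    using bound by blast
  then show ?thesis using decidable_bounded_ex[OF P b] by simp
qed

lemma decidable_member: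
  assumes "finite A" "total_rec f"
  shows "decidable (\<lambda>x. f x \<in> A)"
  using assms(1)
  by (induction A rule: finite_induct)
    (auto intro!: decidable_const decidable_disj decidable_eq total_rec_const assms(2))

lemmas decidable_intros = decidable_const decidable_not decidable_conj decidable_disj
  decidable_iff_pred decidable_le decidable_less decidable_eq

section \<open>Codes of lists\<close>

text \<open>\<open>list_encode\<close> puts a \<open>Suc\<close> around the pair of head and tail,
  which \<open>t - 1\<close> strips off.\<close>

definition tl_code :: "nat \<Rightarrow> nat" where "tl_code t = psnd (t - 1)"

definition nth_code :: "nat \<Rightarrow> nat \<Rightarrow> nat" where
  "nth_code t k = pfst ((tl_code ^^ k) t - 1)"

definition mem_code :: "nat \<Rightarrow> nat \<Rightarrow> bool" where
  "mem_code c t \<longleftrightarrow> c \<in> set (list_decode t)"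

lemma mem_code_0 [simp]: "\<not> mem_code c 0"
  by (simp add: mem_code_def)

lemma mem_code_Suc [simp]: "mem_code c (Suc (prod_encode (a, t))) \<longleftrightarrow> c = a \<or> mem_code c t"
  by (simp add: mem_code_def)

lemma funpow_tl_code: "(tl_code ^^ k) (list_encode xs) = list_encode (drop k xs)"
proof (induction k)
  case (Suc k)
  \<comment> \<open>This makes the code of the empty list its own tail, in agreement with
    \<open>tl [] = []\<close>.\<close>
  have "psnd 0 = 0"
    using le_prod_encode_2[of "psnd 0" "pfst 0"] by simp
  then have "tl_code (list_encode ys) = list_encode (tl ys)" for ys
    by (cases ys) (auto simp: tl_code_def)
  with Suc show ?case by (simp add: drop_Suc drop_tl)
qed simp

lemma nth_code_list_encode: "k < length xs \<Longrightarrow> nth_code (list_encode xs) k = xs ! k"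
  by (simp add: nth_code_def funpow_tl_code flip: Cons_nth_drop_Suc)

lemma length_le_list_encode: "length xs \<le> list_encode xs"
proof (induction xs)
  case (Cons a xs)
  then show ?case using le_prod_encode_2[of "list_encode xs" a] by simp
qed simp

lemma mem_code_less: "mem_code c t \<Longrightarrow> c < t"
proof -
  have "c \<in> set xs \<Longrightarrow> c < list_encode xs" for xs
  proof (induction xs)
    case (Cons a xs)
    then show ?case
      using le_prod_encode_2[of "list_encode xs" a] le_prod_encode_1[of a "list_encode xs"] by auto
  qed simp
  from this[of "list_decode t"] show "mem_code c t \<Longrightarrow> c < t"
    by (simp add: mem_code_def)
qed

text \<open>Turns decoding into a bounded search: a list is no longer than its code, and its
  \<open>k\<close>-th tail has a nonzero code exactly when \<open>k\<close> is a valid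
  index.\<close>

lemma mem_code_iff: "mem_code c t \<longleftrightarrow> (\<exists>k<t. (tl_code ^^ k) t \<noteq> 0 \<and> nth_code t k = c)"
proof -
  define xs where "xs = list_decode t"
  have t: "t = list_encode xs" by (simp add: xs_def)
  have "list_encode ys = 0 \<longleftrightarrow> ys = []" for ys
    by (cases ys) auto
  then have nonempty: "(tl_code ^^ k) t \<noteq> 0 \<longleftrightarrow> k < length xs" for k
    unfolding t by (simp add: funpow_tl_code not_le)
  have nth: "k < length xs \<Longrightarrow> nth_code t k = xs ! k" for k
    unfolding t by (rule nth_code_list_encode)
  have "length xs \<le> t"
    unfolding t by (rule length_le_list_encode)
  then have "(\<exists>k<t. k < length xs \<and> nth_code t k = c) \<longleftrightarrow> (\<exists>k<length xs. xs ! k = c)"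
    using nth by (metis less_le_trans)
  then show ?thesis
    unfolding nonempty mem_code_def xs_def[symmetric] in_set_conv_nth by blast
qed

lemma total_rec_funpow_tl_code:
  assumes "total_rec f" "total_rec g"
  shows "total_rec (\<lambda>x. (tl_code ^^ g x) (f x))"
proof -
  have "total_rec (\<lambda>x. rec_nat (f x) (\<lambda>k r. tl_code r) (g x))"
    unfolding tl_code_def
    by (intro total_rec_rec_nat total_rec_psnd total_rec_pred total_rec_basic assms)
  moreover have "rec_nat a (\<lambda>k r. tl_code r) m = (tl_code ^^ m) a" for a m
    by (induction m) auto
  ultimately show ?thesis by simp
qed

lemma total_rec_nth_code:
  assumes "total_rec f" "total_rec g"
  shows "total_rec (\<lambda>x. nth_code (f x) (g x))"
  unfolding nth_code_def
  by (intro total_rec_pfst total_rec_pred total_rec_funpow_tl_code assms)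

lemma decidable_mem_code:
  assumes "total_rec f" "total_rec g"
  shows "decidable (\<lambda>x. mem_code (f x) (g x))"
  unfolding mem_code_iff
  by (intro decidable_bounded_ex decidable_intros total_rec_funpow_tl_code total_rec_nth_code
      total_rec_basic compose[OF assms(1)] compose[OF assms(2)] assms)

lemma total_rec_list_encode_map:
  assumes "\<And>i. total_rec (f i)"
  shows "total_rec (\<lambda>x. list_encode (map (\<lambda>i. f i x) ks))"
  by (induction ks) (auto intro!: total_rec_basic assms)

section \<open>A universal recursively enumerable evaluation relation\<close>

definition fact_code :: "nat \<Rightarrow> nat \<Rightarrow> nat \<Rightarrow> nat" where
  "fact_code e x v = prod_encode (e, prod_encode (x, v))"

text \<open>The tag \<open>k\<close> selects a rule of \<open>justified_by\<close>; \<open>a\<close>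
  and \<open>b\<close> are the indices of the subprograms that the rule calls.\<close>

definition program :: "nat \<Rightarrow> nat \<Rightarrow> nat \<Rightarrow> nat" where
  "program k a b = prod_encode (k, prod_encode (a, b))"

text \<open>A number \<open>fact_code e x v\<close> is read as ``program \<open>e\<close> on input \<open>x\<close> has value \<open>v\<close>''. It is
  justified by a list \<open>t\<close> of such facts if it is the conclusion of an evaluation rule whose premises
  occur in \<open>t\<close>; there is one rule for each clause in the definition of \<open>total_rec\<close>.\<close>

definition justified_by :: "nat \<Rightarrow> nat \<Rightarrow> nat \<Rightarrow> nat \<Rightarrow> nat \<Rightarrow> nat \<Rightarrow> nat \<Rightarrow> bool" where
  "justified_by t e k a b x v \<longleftrightarrow>
     k = 0 \<and> v = 0
   \<or> k = 1 \<and> v = Suc x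
   \<or> k = 2 \<and> v = x
   \<or> k = 3 \<and> v = pfst x
   \<or> k = 4 \<and> v = psnd x
   \<or> k = 5 \<and> (\<exists>w. mem_code (fact_code b x w) t \<and> mem_code (fact_code a w v) t)
   \<or> k = 6 \<and> mem_code (fact_code a x (pfst v)) t \<and> mem_code (fact_code b x (psnd v)) t
   \<or> k = 7 \<and> psnd x = 0 \<and> mem_code (fact_code a (pfst x) v) t
   \<or> k = 7 \<and> psnd x \<noteq> 0 \<and> (\<exists>r. mem_code (fact_code e (prod_encode (pfst x, psnd x - 1)) r) t
        \<and> mem_code (fact_code b (prod_encode (pfst x, prod_encode (psnd x - 1, r))) v) t)
   \<or> k = 8 \<and> mem_code (fact_code a (prod_encode (x, v)) 0) t
        \<and> (\<forall>y<v. \<exists>r. mem_code (fact_code a (prod_encode (x, y)) (Suc r)) t)"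

definition justified :: "nat \<Rightarrow> nat \<Rightarrow> bool" where
  "justified t c = justified_by t (pfst c) (pfst (pfst c)) (pfst (psnd (pfst c)))
     (psnd (psnd (pfst c))) (pfst (psnd c)) (psnd (psnd c))"

text \<open>The candidate at step \<open>s\<close> is \<open>pfst s\<close>; \<open>psnd s\<close>
  is padding that makes every candidate recur infinitely often. A new fact rests on earlier ones
  only, so derivations are well-founded.\<close>

primrec stage :: "nat \<Rightarrow> nat" where
  "stage 0 = 0"
| "stage (Suc s) = (if justified (stage s) (pfst s) then Suc (prod_encode (pfst s, stage s)) else stage s)"

definition evaluates :: "nat \<Rightarrow> nat \<Rightarrow> nat \<Rightarrow> bool" where
  "evaluates e x v \<longleftrightarrow> (\<exists>s. mem_code (fact_code e x v) (stage s))"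

section \<open>Growth of the stages and uniqueness of values\<close>

lemma justified_mono:
  assumes "\<And>d. mem_code d t \<Longrightarrow> mem_code d t'" "justified t c"
  shows "justified t' c"
  \<comment> \<open>Membership in \<open>t\<close> occurs only positively in the rules: even the
    demand of minimisation that the values below \<open>v\<close> be nonzero is stated through facts
    with value \<open>Suc r\<close>.\<close>
  using assms(2) unfolding justified_def justified_by_def
  by (elim disj_forward conj_forward ex_forward all_forward imp_forward) (assumption | erule assms(1))+

lemma mem_stage_mono: "s \<le> s' \<Longrightarrow> mem_code c (stage s) \<Longrightarrow> mem_code c (stage s')"
  by (induction s' rule: dec_induct) auto

lemma mem_stage_justified: "mem_code c (stage s) \<Longrightarrow> justified (stage s) c"
proof (induction s)
  case (Suc s)
  show ?case
  proof (rule justified_mono)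
    show "mem_code d (stage s) \<Longrightarrow> mem_code d (stage (Suc s))" for d
      by simp
    show "justified (stage s) c"
      using Suc by (auto split: if_splits)
  qed
qed simp

text \<open>For a given program and input at most one rule applies, and it determines the value from
  values recorded in \<open>t\<close>, which are unique by hypothesis.\<close>

lemma justified_functional:
  assumes fn: "\<And>e x v v'. mem_code (fact_code e x v) t \<Longrightarrow> mem_code (fact_code e x v') t \<Longrightarrow> v = v'"
    and "justified t (fact_code e x v)" "justified t (fact_code e x v')"
  shows "v = v'"
proof -
  define k a b where kab: "k = pfst e" "a = pfst (psnd e)" "b = psnd (psnd e)"
  have j: "justified_by t e k a b x v" "justified_by t e k a b x v'"
    using assms(2,3) by (simp_all add: justified_def fact_code_def kab)
  consider "k < 5" | "k = 5" | "k = 6" | "k = 7" | "k = 8" | "k > 8" by linarith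
  then show ?thesis
  proof cases
    case 1
    with j show ?thesis by (auto simp: justified_by_def)
  next
    case 2
    with j show ?thesis by (auto simp: justified_by_def) (metis fn)
  next
    case 3
    with j have "pfst v = pfst v'" "psnd v = psnd v'"
      by (auto simp: justified_by_def intro: fn)
    then show ?thesis by (metis prod.expand prod_decode_eq)
  next
    case 4
    with j show ?thesis by (auto simp: justified_by_def intro: fn) (metis fn)
  next
    case 5
    \<comment> \<open>For \<open>w'\<close> to be a least zero, the value at the smaller argument
      \<open>w\<close> must be nonzero, while \<open>w\<close> itself demands the value 0
      there.\<close>
    have "\<not> w < w'" if "justified_by t e k a b x w" "justified_by t e k a b x w'" for w w'
    proof
      assume "w < w'"
      with that 5 obtain r where "mem_code (fact_code a (prod_encode (x, w)) (Suc r)) t"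
        "mem_code (fact_code a (prod_encode (x, w)) 0) t"
        by (auto simp: justified_by_def)
      from fn[OF this] show False by simp
    qed
    with j show ?thesis by (meson linorder_neqE_nat)
  next
    case 6
    with j show ?thesis by (auto simp: justified_by_def)
  qed
qed

lemma stage_functional:
  "mem_code (fact_code e x v) (stage s) \<Longrightarrow> mem_code (fact_code e x v') (stage s) \<Longrightarrow> v = v'"
proof (induction s arbitrary: e x v v')
  case (Suc s)
  \<comment> \<open>New or old, a fact of the later stage has its premises in the earlier one, where
    values are unique by induction.\<close>
  have "justified (stage s) (fact_code e x w)" if "mem_code (fact_code e x w) (stage (Suc s))" for w
    using that mem_stage_justified by (auto split: if_splits)
  then have "justified (stage s) (fact_code e x v)" "justified (stage s) (fact_code e x v')"
    using Suc.prems by blast+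
  then show ?case by (rule justified_functional[rotated]) (rule Suc.IH)
qed simp

lemma evaluates_functional: "evaluates e x v \<Longrightarrow> evaluates e x v' \<Longrightarrow> v = v'"
  unfolding evaluates_def by (meson mem_stage_mono nat_le_linear stage_functional)

text \<open>Every candidate fact is examined at arbitrarily late stages, so no justified fact is missed.\<close>

lemma evaluatesI:
  assumes "justified_by (stage s) (program k a b) k a b x v"
  shows "evaluates (program k a b) x v"
proof -
  define c where "c = fact_code (program k a b) x v"
  define s' where "s' = prod_encode (c, s)"
  have "justified (stage s) c"
    using assms by (simp add: justified_def c_def fact_code_def program_def)
  moreover have "s \<le> s'"
    by (simp add: s'_def le_prod_encode_2)
  ultimately have "justified (stage s') c"
    by (intro justified_mono[OF mem_stage_mono])
  then have "mem_code c (stage (Suc s'))"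
    unfolding stage.simps by (simp add: s'_def)
  then show ?thesis
    unfolding evaluates_def c_def by blast
qed

section \<open>Programs for all recursive functions\<close>

lemma evaluates_common_stage:
  assumes "evaluates e x v" "evaluates e' x' v'"
  obtains s where "mem_code (fact_code e x v) (stage s)" "mem_code (fact_code e' x' v') (stage s)"
proof -
  obtain s s' where "mem_code (fact_code e x v) (stage s)" "mem_code (fact_code e' x' v') (stage s')"
    using assms unfolding evaluates_def by blast
  then show thesis
    using that[of "max s s'"] mem_stage_mono[of s "max s s'"] mem_stage_mono[of s' "max s s'"] by simp
qed

text \<open>A rule needs all its premises in one stage; finitely many facts share one because the
  stages only grow.\<close>

lemma evaluates_all_common_stage:
  fixes m :: nat
  assumes "\<And>y. y < m \<Longrightarrow> evaluates e (f y) (g y)"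
  shows "\<exists>s. \<forall>y<m. mem_code (fact_code e (f y) (g y)) (stage s)"
  using assms
proof (induction m)
  case (Suc m)
  then obtain s where s: "\<forall>y<m. mem_code (fact_code e (f y) (g y)) (stage s)"
    by auto
  obtain s' where s': "mem_code (fact_code e (f m) (g m)) (stage s')"
    using Suc.prems[of m] unfolding evaluates_def by blast
  have "\<forall>y<Suc m. mem_code (fact_code e (f y) (g y)) (stage (max s s'))"
    using s s' mem_stage_mono[OF max.cobounded1] mem_stage_mono[OF max.cobounded2]
    by (auto simp: less_Suc_eq)
  then show ?case by blast
qed simp

lemma evaluates_prim_rec:
  assumes g: "\<And>x. evaluates a x (g x)" and h: "\<And>x. evaluates b x (h x)"
  shows "evaluates (program 7 a b) x (prim_rec_op g h x)"
proof -
  let ?r = "\<lambda>y. rec_nat (g y) (\<lambda>k r. h (prod_encode (y, prod_encode (k, r))))"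
  have "evaluates (program 7 a b) (prod_encode (y, m)) (?r y m)" for y m
  proof (induction m)
    case 0
    obtain s where "mem_code (fact_code a y (g y)) (stage s)"
      using g[of y] unfolding evaluates_def by blast
    then show ?case
      by (intro evaluatesI[of s]) (simp add: justified_by_def)
  next
    case (Suc m)
    obtain s where "mem_code (fact_code (program 7 a b) (prod_encode (y, m)) (?r y m)) (stage s)"
      "mem_code (fact_code b (prod_encode (y, prod_encode (m, ?r y m))) (?r y (Suc m))) (stage s)"
      using evaluates_common_stage[OF Suc h[of "prod_encode (y, prod_encode (m, ?r y m))"]] by auto
    then show ?case
      by (intro evaluatesI[of s]) (auto simp: justified_by_def)
  qed
  from this[of "pfst x" "psnd x"] show ?thesis
    by (simp add: prim_rec_op_def split_beta)
qed

lemma evaluates_minimize: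
  assumes g: "\<And>x. evaluates a x (g x)" and total: "\<exists>y. g (prod_encode (x, y)) = 0"
  shows "evaluates (program 8 a b) x (LEAST y. g (prod_encode (x, y)) = 0)"
proof -
  define m where "m = (LEAST y. g (prod_encode (x, y)) = 0)"
  have zero: "g (prod_encode (x, m)) = 0"
    using total unfolding m_def by (rule LeastI_ex)
  have nonzero: "\<exists>r. g (prod_encode (x, y)) = Suc r" if "y < m" for y
    using that not_less_Least not0_implies_Suc unfolding m_def by blast
  \<comment> \<open>The range includes \<open>m\<close> itself, since the rule asks for the zero at
    \<open>m\<close> as well as for the nonzero values below it.\<close>
  obtain s where s: "\<forall>y<Suc m. mem_code (fact_code a (prod_encode (x, y)) (g (prod_encode (x, y)))) (stage s)"
    using evaluates_all_common_stage[of "Suc m" a "\<lambda>y. prod_encode (x, y)", OF g] by (elim exE)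
  have "mem_code (fact_code a (prod_encode (x, m)) 0) (stage s)"
    using s[rule_format, of m] zero by simp
  moreover have "\<exists>r. mem_code (fact_code a (prod_encode (x, y)) (Suc r)) (stage s)" if "y < m" for y
    using s[rule_format, of y] nonzero[OF that] that by auto
  ultimately show ?thesis
    unfolding m_def[symmetric] by (intro evaluatesI[of s]) (simp add: justified_by_def)
qed

text \<open>Each clause of \<open>total_rec\<close> has its own evaluation rule. The rules for the
  initial functions have no premises, so they already fire at stage 0.\<close>

theorem total_rec_evaluates:
  assumes "total_rec f"
  shows "\<exists>e. \<forall>x. evaluates e x (f x)"
  using assms
proof induction
  case zero_fn
  show ?case by (intro exI[of _ "program 0 0 0"] allI evaluatesI[of 0]) (simp add: justified_by_def)
next
  case succ_fn
  show ?case by (intro exI[of _ "program 1 0 0"] allI evaluatesI[of 0]) (simp add: justified_by_def)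
next
  case ident_fn
  show ?case by (intro exI[of _ "program 2 0 0"] allI evaluatesI[of 0]) (simp add: justified_by_def)
next
  case fst_dec
  show ?case by (intro exI[of _ "program 3 0 0"] allI evaluatesI[of 0]) (simp add: justified_by_def)
next
  case snd_dec
  show ?case by (intro exI[of _ "program 4 0 0"] allI evaluatesI[of 0]) (simp add: justified_by_def)
next
  case (compose f g)
  then obtain a b where a: "\<And>x. evaluates a x (f x)" and b: "\<And>x. evaluates b x (g x)"
    by blast
  have "evaluates (program 5 a b) x (f (g x))" for x
    proof -
    obtain s where "mem_code (fact_code b x (g x)) (stage s)" "mem_code (fact_code a (g x) (f (g x))) (stage s)"
      using evaluates_common_stage[OF b a] by blast
    then show ?thesis by (intro evaluatesI[of s]) (auto simp: justified_by_def)
  qed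
  then show ?case by blast
next
  case (pairing f g)
  then obtain a b where a: "\<And>x. evaluates a x (f x)" and b: "\<And>x. evaluates b x (g x)"
    by blast
  have "evaluates (program 6 a b) x (prod_encode (f x, g x))" for x
    proof -
    obtain s where "mem_code (fact_code a x (f x)) (stage s)" "mem_code (fact_code b x (g x)) (stage s)"
      using evaluates_common_stage[OF a b] by blast
    then show ?thesis by (intro evaluatesI[of s]) (auto simp: justified_by_def)
  qed
  then show ?case by blast
next
  case (prim_rec g h)
  then show ?case using evaluates_prim_rec by blast
next
  case (minimize g)
  then show ?case using evaluates_minimize by blast
qed

text \<open>Uniqueness of values prevents an index of the characteristic function from also yielding
  1 outside \<open>R\<close>.\<close>

lemma computable_set_evaluates:
  assumes "computable_set R"
  shows "\<exists>e. \<forall>x. evaluates e x 1 \<longleftrightarrow> x \<in> R"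
proof -
  obtain e where "\<And>x. evaluates e x (if x \<in> R then 1 else 0)"
    using total_rec_evaluates assms unfolding computable_set_def by blast
  then have "evaluates e x 1 \<longleftrightarrow> x \<in> R" for x
    using evaluates_functional[of e x 1 "if x \<in> R then 1 else 0"]
    by (metis zero_neq_one)
  then show ?thesis by blast
qed

section \<open>Decidability of the enumeration of facts\<close>

lemma mem_fact_code_less: "mem_code (fact_code e x v) t \<Longrightarrow> v < t"
  using mem_code_less[of "fact_code e x v" t] le_prod_encode_2[of v x] le_prod_encode_2[of "prod_encode (x, v)" e]
  by (simp add: fact_code_def)

lemma total_rec_fact_code:
  assumes "total_rec e" "total_rec f" "total_rec g"
  shows "total_rec (\<lambda>x. fact_code (e x) (f x) (g x))"
  unfolding fact_code_def by (intro pairing assms)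

lemma decidable_justified: "decidable (\<lambda>p. justified (pfst p) (psnd p))"
proof -
  \<comment> \<open>A value recorded in \<open>t\<close> is smaller than \<open>t\<close>, which
    bounds the quantifiers over intermediate values. The rules need \<open>g\<close> to be the
    identity or \<open>Suc\<close>.\<close>
  have bounded: "decidable (\<lambda>x. \<exists>r. mem_code (fact_code (e x) (f x) (g r)) (t x) \<and> Q x r)"
    if "total_rec e" "total_rec f" "total_rec g" "total_rec t" "\<And>r. r \<le> g r"
      "decidable (\<lambda>p. Q (pfst p) (psnd p))" for e f g t Q
  proof (rule decidable_ex_bounded)
    show "decidable (\<lambda>p. mem_code (fact_code (e (pfst p)) (f (pfst p)) (g (psnd p))) (t (pfst p))
        \<and> Q (pfst p) (psnd p))"
      by (intro decidable_conj decidable_mem_code total_rec_fact_code that(6)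
          compose[OF that(1)] compose[OF that(2)] compose[OF that(3)] compose[OF that(4)] total_rec_basic)
  qed (use that(4) that(5) mem_fact_code_less le_less_trans in blast)+
  note ex_conj = bounded[where g = "\<lambda>r. r"]
  have ex_Suc: "decidable (\<lambda>x. \<exists>r. mem_code (fact_code (e x) (f x) (Suc r)) (t x))"
    if "total_rec e" "total_rec f" "total_rec t" for e f t
    using bounded[OF that(1,2) succ_fn that(3) _ decidable_const[of True]] by simp
  show ?thesis
    unfolding justified_def justified_by_def
    by (intro decidable_intros ex_conj ex_Suc decidable_bounded_all decidable_mem_code
        total_rec_fact_code total_rec_basic total_rec_pred) simp_all
qed

lemma decidable_mem_stage:
  assumes "total_rec f" "total_rec g"
  shows "decidable (\<lambda>x. mem_code (f x) (stage (g x)))"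
proof (intro decidable_mem_code assms)
  let ?h = "\<lambda>s t. if justified t (pfst s) then Suc (prod_encode (pfst s, t)) else t"
  have "decidable (\<lambda>q. justified (psnd (psnd q)) (pfst (pfst (psnd q))))"
    using decidable_compose[OF decidable_justified,
        of "\<lambda>q. prod_encode (psnd (psnd q), pfst (pfst (psnd q)))"]
    by (simp add: total_rec_basic)
  then have "total_rec (\<lambda>x. rec_nat 0 ?h (g x))"
    by (intro total_rec_rec_nat total_rec_if total_rec_basic assms)
  then show "total_rec (\<lambda>x. stage (g x))"
    by (simp add: stage_def)
qed

section \<open>Predicates of low arithmetical complexity\<close>

definition sigma1 :: "(nat \<Rightarrow> bool) \<Rightarrow> bool" where
  "sigma1 Q \<longleftrightarrow> (\<exists>R. decidable (\<lambda>p. R (pfst p) (psnd p)) \<and> (\<forall>x. Q x \<longleftrightarrow> (\<exists>v. R x v)))"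

definition pi2 :: "(nat \<Rightarrow> bool) \<Rightarrow> bool" where
  "pi2 Q \<longleftrightarrow> (\<exists>S. sigma1 (\<lambda>p. S (pfst p) (psnd p)) \<and> (\<forall>x. Q x \<longleftrightarrow> (\<forall>u. S x u)))"

lemma decidable_compose2:
  assumes "decidable (\<lambda>p. R (pfst p) (psnd p))" "total_rec f" "total_rec g"
  shows "decidable (\<lambda>x. R (f x) (g x))"
  using decidable_compose[OF assms(1) pairing[OF assms(2,3)]] by simp

lemma sigma1_decidable: "decidable Q \<Longrightarrow> sigma1 Q"
  unfolding sigma1_def
  by (rule exI[of _ "\<lambda>x v. Q x"]) (auto intro: decidable_compose[OF _ fst_dec])

lemma sigma1_compose:
  assumes "sigma1 Q" "total_rec f"
  shows "sigma1 (\<lambda>x. Q (f x))"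
proof -
  obtain R where R: "decidable (\<lambda>p. R (pfst p) (psnd p))" "\<And>x. Q x \<longleftrightarrow> (\<exists>v. R x v)"
    using assms(1) unfolding sigma1_def by blast
  have "decidable (\<lambda>p. R (f (pfst p)) (psnd p))"
    by (intro decidable_compose2[OF R(1)] compose[OF assms(2)] total_rec_basic)
  then show ?thesis
    unfolding sigma1_def R(2) by (intro exI[of _ "\<lambda>x v. R (f x) v"]) blast
qed

lemma sigma1_compose2:
  assumes "sigma1 (\<lambda>p. S (pfst p) (psnd p))" "total_rec f" "total_rec g"
  shows "sigma1 (\<lambda>x. S (f x) (g x))"
  using sigma1_compose[OF assms(1) pairing[OF assms(2,3)]] by simp

lemma sigma1_ex:
  assumes "sigma1 (\<lambda>p. S (pfst p) (psnd p))"
  shows "sigma1 (\<lambda>x. \<exists>y. S x y)"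
proof -
  obtain R where R: "decidable (\<lambda>p. R (pfst p) (psnd p))"
    "\<And>p. S (pfst p) (psnd p) \<longleftrightarrow> (\<exists>v. R p v)"
    using assms unfolding sigma1_def by blast
  have "decidable (\<lambda>p. R (prod_encode (pfst p, pfst (psnd p))) (psnd (psnd p)))"
    by (intro decidable_compose2[OF R(1)] total_rec_basic)
  moreover have "(\<exists>y. S x y) \<longleftrightarrow> (\<exists>w. R (prod_encode (x, pfst w)) (psnd w))" for x
    using R(2)[of "prod_encode (x, _)"]
    by (metis fst_conv prod_encode_inverse snd_conv)
  ultimately show ?thesis
    unfolding sigma1_def
    by (intro exI[of _ "\<lambda>x w. R (prod_encode (x, pfst w)) (psnd w)"]) blast
qed

lemma sigma1_conj:
  assumes "sigma1 P" "sigma1 Q"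
  shows "sigma1 (\<lambda>x. P x \<and> Q x)"
proof -
  obtain R where R: "decidable (\<lambda>p. R (pfst p) (psnd p))" "\<And>x. P x \<longleftrightarrow> (\<exists>v. R x v)"
    using assms(1) unfolding sigma1_def by blast
  obtain S where S: "decidable (\<lambda>p. S (pfst p) (psnd p))" "\<And>x. Q x \<longleftrightarrow> (\<exists>v. S x v)"
    using assms(2) unfolding sigma1_def by blast
  have "decidable (\<lambda>p. R (pfst p) (pfst (psnd p)) \<and> S (pfst p) (psnd (psnd p)))"
    by (intro decidable_conj decidable_compose2[OF R(1)] decidable_compose2[OF S(1)] total_rec_basic)
  moreover have "P x \<and> Q x \<longleftrightarrow> (\<exists>w. R x (pfst w) \<and> S x (psnd w))" for x
    unfolding R(2) S(2) by (metis fst_conv prod_encode_inverse snd_conv)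
  ultimately show ?thesis
    unfolding sigma1_def
    by (intro exI[of _ "\<lambda>x w. R x (pfst w) \<and> S x (psnd w)"]) blast
qed

lemma sigma1_disj:
  assumes "sigma1 P" "sigma1 Q"
  shows "sigma1 (\<lambda>x. P x \<or> Q x)"
proof -
  obtain R where R: "decidable (\<lambda>p. R (pfst p) (psnd p))" "\<And>x. P x \<longleftrightarrow> (\<exists>v. R x v)"
    using assms(1) unfolding sigma1_def by blast
  obtain S where S: "decidable (\<lambda>p. S (pfst p) (psnd p))" "\<And>x. Q x \<longleftrightarrow> (\<exists>v. S x v)"
    using assms(2) unfolding sigma1_def by blast
  have "decidable (\<lambda>p. R (pfst p) (psnd p) \<or> S (pfst p) (psnd p))"
    by (intro decidable_disj R S)
  moreover have "P x \<or> Q x \<longleftrightarrow> (\<exists>w. R x w \<or> S x w)" for x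
    unfolding R(2) S(2) by blast
  ultimately show ?thesis
    unfolding sigma1_def by (intro exI[of _ "\<lambda>x w. R x w \<or> S x w"]) blast
qed

lemma sigma1_evaluates:
  assumes "total_rec e" "total_rec f" "total_rec g"
  shows "sigma1 (\<lambda>x. evaluates (e x) (f x) (g x))"
  unfolding evaluates_def
  by (intro sigma1_ex sigma1_decidable decidable_mem_stage total_rec_fact_code total_rec_basic
      compose[OF assms(1)] compose[OF assms(2)] compose[OF assms(3)])

lemma pi2_sigma1: "sigma1 Q \<Longrightarrow> pi2 Q"
  unfolding pi2_def
  by (rule exI[of _ "\<lambda>x v. Q x"]) (auto intro: sigma1_compose[OF _ fst_dec])

lemma pi2_conj:
  assumes "pi2 P" "pi2 Q"
  shows "pi2 (\<lambda>x. P x \<and> Q x)"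
proof -
  obtain R where R: "sigma1 (\<lambda>p. R (pfst p) (psnd p))" "\<And>x. P x \<longleftrightarrow> (\<forall>u. R x u)"
    using assms(1) unfolding pi2_def by blast
  obtain S where S: "sigma1 (\<lambda>p. S (pfst p) (psnd p))" "\<And>x. Q x \<longleftrightarrow> (\<forall>u. S x u)"
    using assms(2) unfolding pi2_def by blast
  have "sigma1 (\<lambda>p. R (pfst p) (psnd p) \<and> S (pfst p) (psnd p))"
    by (intro sigma1_conj R S)
  moreover have "P x \<and> Q x \<longleftrightarrow> (\<forall>u. R x u \<and> S x u)" for x
    unfolding R(2) S(2) by blast
  ultimately show ?thesis
    unfolding pi2_def by (intro exI[of _ "\<lambda>x u. R x u \<and> S x u"]) blast
qed

text \<open>A universal quantifier does not distribute over a disjunction, so both disjuncts get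
  independent variables, packed into a single \<open>u\<close>.\<close>

lemma pi2_disj:
  assumes "pi2 P" "pi2 Q"
  shows "pi2 (\<lambda>x. P x \<or> Q x)"
proof -
  obtain R where R: "sigma1 (\<lambda>p. R (pfst p) (psnd p))" "\<And>x. P x \<longleftrightarrow> (\<forall>u. R x u)"
    using assms(1) unfolding pi2_def by blast
  obtain S where S: "sigma1 (\<lambda>p. S (pfst p) (psnd p))" "\<And>x. Q x \<longleftrightarrow> (\<forall>u. S x u)"
    using assms(2) unfolding pi2_def by blast
  have "sigma1 (\<lambda>p. R (pfst p) (pfst (psnd p)) \<or> S (pfst p) (psnd (psnd p)))"
    by (intro sigma1_disj sigma1_compose2[OF R(1)] sigma1_compose2[OF S(1)] total_rec_basic)
  moreover have "P x \<or> Q x \<longleftrightarrow> (\<forall>u. R x (pfst u) \<or> S x (psnd u))" for x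
    unfolding R(2) S(2) by (metis fst_conv prod_encode_inverse snd_conv)
  ultimately show ?thesis
    unfolding pi2_def by (intro exI[of _ "\<lambda>x u. R x (pfst u) \<or> S x (psnd u)"]) blast
qed

lemma pi2_all_sigma1:
  assumes "sigma1 (\<lambda>p. S (pfst p) (psnd p))"
  shows "pi2 (\<lambda>x. \<forall>u. S x u)"
  using assms unfolding pi2_def by blast

lemma pi2_finite_ball:
  assumes "finite I" "\<And>i. i \<in> I \<Longrightarrow> pi2 (Q i)"
  shows "pi2 (\<lambda>x. \<forall>i\<in>I. Q i x)"
  using assms
  by (induction I rule: finite_induct)
    (auto intro: pi2_conj pi2_sigma1 sigma1_decidable decidable_const)

lemma pi2_finite_bex:
  assumes "finite I" "\<And>i. i \<in> I \<Longrightarrow> pi2 (Q i)"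
  shows "pi2 (\<lambda>x. \<exists>i\<in>I. Q i x)"
  using assms
  by (induction I rule: finite_induct)
    (auto intro: pi2_disj pi2_sigma1 sigma1_decidable decidable_const)

lemma Pi02I:
  assumes "pi2 (\<lambda>p. (pfst p, psnd p) \<in> E)"
  shows "Pi02 E"
proof -
  obtain S where S: "sigma1 (\<lambda>p. S (pfst p) (psnd p))"
    "\<And>p. (pfst p, psnd p) \<in> E \<longleftrightarrow> (\<forall>u. S p u)"
    using assms unfolding pi2_def by blast
  obtain R where R: "decidable (\<lambda>p. R (pfst p) (psnd p))"
    "\<And>p. S (pfst p) (psnd p) \<longleftrightarrow> (\<exists>v. R p v)"
    using S(1) unfolding sigma1_def by blast
  have "(x, y) \<in> E \<longleftrightarrow> (\<forall>u. \<exists>v. R (prod_encode (prod_encode (x, y), u)) v)" for x y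
    using S(2)[of "prod_encode (x, y)"] R(2)[of "prod_encode (prod_encode (x, y), _)"] by simp
  moreover have "decidable (\<lambda>q. R (prod_encode (pfst q, pfst (psnd q))) (psnd (psnd q)))"
    by (intro decidable_compose2[OF R(1)] total_rec_basic)
  ultimately show ?thesis
    unfolding Pi02_def decidable_def
    by (intro exI[of _ "{q. R (prod_encode (pfst q, pfst (psnd q))) (psnd (psnd q))}"]) simp
qed

section \<open>The relation complete for tuples of length \<open>n\<close>\<close>

text \<open>A universal \<Pi>-0-2 relation: every \<Pi>-0-2 relation has an index \<open>e\<close>,
  but for arbitrary \<open>e\<close> the result need not be an equivalence.\<close>

definition coded_rel :: "nat \<Rightarrow> nat \<Rightarrow> nat \<Rightarrow> bool" where
  "coded_rel e x y \<longleftrightarrow>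
     (\<forall>u. \<exists>v. evaluates e (prod_encode (prod_encode (x, y), prod_encode (u, v))) 1)"

definition slot :: "nat \<Rightarrow> nat \<Rightarrow> nat" where
  "slot n a = (if psnd a < n then psnd a else 0)"

text \<open>The block of \<open>\<langle>e, z\<rangle>\<close> consists of the \<open>\<langle>\<langle>e, z\<rangle>, i\<rangle>\<close>, where \<open>i \<ge> n\<close> is identified with
  \<open>0\<close>. Writing \<open>P i j\<close> for \<open>coded_rel e (z ! i) (z ! j)\<close>, the slots \<open>i\<close> and \<open>j\<close> are related unless
  they are separated by a set \<open>A\<close> with no \<open>P\<close>-edge from \<open>A\<close> to its complement. This is an
  equivalence relation for every \<open>P\<close>, and it is \<open>P\<close> itself if \<open>P\<close> is one.\<close>

definition block_rel :: "nat \<Rightarrow> (nat \<times> nat) set" where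
  "block_rel n = {(a, b). pfst a = pfst b \<and>
     (\<forall>A\<in>Pow {..<n}. (slot n a \<in> A \<longleftrightarrow> slot n b \<in> A) \<or>
        (\<exists>p\<in>A. \<exists>q\<in>{..<n} - A. coded_rel (pfst (pfst a))
            (nth_code (psnd (pfst a)) p) (nth_code (psnd (pfst a)) q)))}"

text \<open>For each fixed \<open>A\<close> the condition defines an equivalence within a block:
  everything is related if some edge leaves \<open>A\<close>, and otherwise the relation is lying on
  the same side of \<open>A\<close>.\<close>

lemma equiv_block_rel: "equiv UNIV (block_rel n)"
proof (rule equivI)
  show "trans (block_rel n)"
  proof (rule transI)
    fix a b c
    assume ab: "(a, b) \<in> block_rel n" and bc: "(b, c) \<in> block_rel n"
    then have eq: "pfst b = pfst a" "pfst c = pfst a"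
      by (simp_all add: block_rel_def)
    \<comment> \<open>\<open>D A\<close> depends on the block only, hence is the same for
      \<open>a\<close>, \<open>b\<close> and \<open>c\<close>.\<close>
    define D where "D A \<longleftrightarrow> (\<exists>p\<in>A. \<exists>q\<in>{..<n} - A. coded_rel (pfst (pfst a))
      (nth_code (psnd (pfst a)) p) (nth_code (psnd (pfst a)) q))" for A
    have "\<forall>A\<in>Pow {..<n}. (slot n a \<in> A \<longleftrightarrow> slot n b \<in> A) \<or> D A"
      "\<forall>A\<in>Pow {..<n}. (slot n b \<in> A \<longleftrightarrow> slot n c \<in> A) \<or> D A"
      using ab bc unfolding block_rel_def mem_Collect_eq prod.case eq D_def by blast+
    then have "\<forall>A\<in>Pow {..<n}. (slot n a \<in> A \<longleftrightarrow> slot n c \<in> A) \<or> D A"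
      by blast
    then show "(a, c) \<in> block_rel n"
      unfolding block_rel_def mem_Collect_eq prod.case eq D_def by blast
  qed
qed (auto simp: block_rel_def refl_on_def sym_def)

lemma pi2_coded_rel:
  assumes "total_rec e" "total_rec f" "total_rec g"
  shows "pi2 (\<lambda>x. coded_rel (e x) (f x) (g x))"
  unfolding coded_rel_def
  by (intro pi2_all_sigma1 sigma1_ex sigma1_evaluates total_rec_basic
      compose[OF assms(1)] compose[OF assms(2)] compose[OF assms(3)])

text \<open>For fixed \<open>n\<close> the sets \<open>A\<close> and the slots \<open>p\<close>,
  \<open>q\<close> range over finite sets, so their quantifiers are finite conjunctions and
  disjunctions, which preserve \<open>pi2\<close>.\<close>

lemma Pi02_block_rel: "Pi02 (block_rel n)"
proof -
  have slot: "total_rec (\<lambda>x. slot n (f x))" if "total_rec f" for f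
    unfolding slot_def by (intro total_rec_if decidable_less total_rec_basic that)
  have "pi2 (\<lambda>x. pfst (pfst x) = pfst (psnd x) \<and>
     (\<forall>A\<in>Pow {..<n}. (slot n (pfst x) \<in> A \<longleftrightarrow> slot n (psnd x) \<in> A) \<or>
        (\<exists>p\<in>A. \<exists>q\<in>{..<n} - A. coded_rel (pfst (pfst (pfst x)))
            (nth_code (psnd (pfst (pfst x))) p) (nth_code (psnd (pfst (pfst x))) q))))"
    by (intro pi2_conj pi2_disj pi2_finite_ball pi2_finite_bex pi2_coded_rel pi2_sigma1[OF sigma1_decidable]
        decidable_eq decidable_iff_pred decidable_member slot total_rec_nth_code total_rec_basic)
      (auto intro: finite_subset[of _ "{..<n}"])
  then show ?thesis
    by (intro Pi02I) (simp add: block_rel_def split_beta)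
qed

lemma coded_rel_universal:
  assumes "Pi02 F"
  shows "\<exists>e. \<forall>x y. coded_rel e x y \<longleftrightarrow> (x, y) \<in> F"
proof -
  obtain R where R: "computable_set R" "\<And>x y. (x, y) \<in> F \<longleftrightarrow>
      (\<forall>u. \<exists>v. prod_encode (prod_encode (x, y), prod_encode (u, v)) \<in> R)"
    using assms unfolding Pi02_def by blast
  obtain e where "\<And>x. evaluates e x 1 \<longleftrightarrow> x \<in> R"
    using computable_set_evaluates[OF R(1)] by blast
  then show ?thesis
    unfolding coded_rel_def R(2) by blast
qed

lemma block_rel_eq:
  assumes F: "equiv UNIV F" and e: "\<And>x y. coded_rel e x y \<longleftrightarrow> (x, y) \<in> F"
    and "length xs = n" "i < n" "j < n"
  defines "w \<equiv> prod_encode (e, list_encode xs)"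
  shows "(prod_encode (w, i), prod_encode (w, j)) \<in> block_rel n \<longleftrightarrow> (xs ! i, xs ! j) \<in> F"
proof -
  have sym: "(y, x) \<in> F" if "(x, y) \<in> F" for x y
    using F that by (auto elim: equivE dest: symD)
  have tr: "(x, z) \<in> F" if "(x, y) \<in> F" "(y, z) \<in> F" for x y z
    using F that by (auto elim: equivE dest: transD)
  have rfl: "(x, x) \<in> F" for x
    using F by (auto elim: equivE dest: refl_onD)
  have "(prod_encode (w, i), prod_encode (w, j)) \<in> block_rel n \<longleftrightarrow>
      (\<forall>A\<in>Pow {..<n}. (i \<in> A \<longleftrightarrow> j \<in> A) \<or>
        (\<exists>p\<in>A. \<exists>q\<in>{..<n} - A. coded_rel e (nth_code (list_encode xs) p) (nth_code (list_encode xs) q)))"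
    using assms(4,5) by (simp add: block_rel_def slot_def w_def)
  also have "\<dots> \<longleftrightarrow> (\<forall>A\<in>Pow {..<n}. (i \<in> A \<longleftrightarrow> j \<in> A) \<or> (\<exists>p\<in>A. \<exists>q\<in>{..<n} - A. (xs ! p, xs ! q) \<in> F))"
  proof (intro ball_cong refl arg_cong2[where f = "(\<or>)"] bex_cong)
    fix A p q
    assume "A \<in> Pow {..<n}" "p \<in> A" "q \<in> {..<n} - A"
    then have "p < n" "q < n" by auto
    then show "coded_rel e (nth_code (list_encode xs) p) (nth_code (list_encode xs) q) \<longleftrightarrow>
        (xs ! p, xs ! q) \<in> F"
      using assms(3) by (simp add: e nth_code_list_encode)
  qed
  also have "\<dots> \<longleftrightarrow> (xs ! i, xs ! j) \<in> F"
  proof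
    assume L: "\<forall>A\<in>Pow {..<n}. (i \<in> A \<longleftrightarrow> j \<in> A) \<or> (\<exists>p\<in>A. \<exists>q\<in>{..<n} - A. (xs ! p, xs ! q) \<in> F)"
    \<comment> \<open>By transitivity no \<open>F\<close>-edge leaves the slots that are
      \<open>F\<close>-equivalent to \<open>i\<close>, so this set may not separate \<open>i\<close>
      from \<open>j\<close>.\<close>
    define A where "A = {k. k < n \<and> (xs ! i, xs ! k) \<in> F}"
    have "\<not> (\<exists>p\<in>A. \<exists>q\<in>{..<n} - A. (xs ! p, xs ! q) \<in> F)"
    proof (intro notI, elim bexE)
      fix p q
      assume "p \<in> A" "q \<in> {..<n} - A" "(xs ! p, xs ! q) \<in> F"
      with tr[of "xs ! i" "xs ! p" "xs ! q"] show False by (simp add: A_def)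
    qed
    moreover have "A \<in> Pow {..<n}" by (auto simp: A_def)
    ultimately have "i \<in> A \<longleftrightarrow> j \<in> A"
      using L by blast
    then show "(xs ! i, xs ! j) \<in> F"
      using rfl[of "xs ! i"] assms(4,5) by (simp add: A_def)
  next
    assume ij: "(xs ! i, xs ! j) \<in> F"
    \<comment> \<open>If \<open>A\<close> contains just one of \<open>i\<close> and
      \<open>j\<close>, the pair itself is an edge leaving \<open>A\<close>, in one of its two
      orders; hence the appeal to symmetry.\<close>
    show "\<forall>A\<in>Pow {..<n}. (i \<in> A \<longleftrightarrow> j \<in> A) \<or> (\<exists>p\<in>A. \<exists>q\<in>{..<n} - A. (xs ! p, xs ! q) \<in> F)"
      using assms(4,5) ij sym[OF ij] by blast
  qed
  finally show ?thesis .
qed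

lemma creducible_n_block_rel:
  assumes "equiv UNIV F" "Pi02 F"
  shows "creducible_n n F (block_rel n)"
proof -
  obtain e where e: "\<And>x y. coded_rel e x y \<longleftrightarrow> (x, y) \<in> F"
    using coded_rel_universal[OF assms(2)] by blast
  \<comment> \<open>The code \<open>z\<close> of the tuple is part of the block index, so the tuple
    is sent to the \<open>n\<close> slots of its own block.\<close>
  let ?f = "\<lambda>z. list_encode (map (\<lambda>i. prod_encode (prod_encode (e, z), i)) [0..<n])"
  have "total_rec ?f"
    by (intro total_rec_list_encode_map total_rec_basic)
  then show ?thesis
    unfolding creducible_n_def
    by (intro exI[of _ ?f]) (auto simp: Let_def block_rel_eq[OF assms(1) e])
qed

section \<open>A relation not reducible on longer tuples\<close>

text \<open>Tuples for different \<open>e\<close> are disjoint, so the diagonalisations against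
  different programs do not interact.\<close>

definition block_tuple :: "nat \<Rightarrow> nat \<Rightarrow> nat list" where
  "block_tuple n e = map (\<lambda>i. prod_encode (e, i)) [0..<n + 1]"

text \<open>A recursively enumerable event: the search for \<open>v\<close> is unbounded, but
  comparing block indices is decidable.\<close>

definition splits :: "nat \<Rightarrow> nat \<Rightarrow> bool" where
  "splits n e \<longleftrightarrow> (\<exists>v. evaluates e (list_encode (block_tuple n e)) v \<and>
     (\<exists>i<n + 1. pfst (nth_code v i) \<noteq> pfst (nth_code v 0)))"

definition diag_rel :: "nat \<Rightarrow> (nat \<times> nat) set" where
  "diag_rel n = {(a, b). a = b \<or> pfst a = pfst b \<and> splits n (pfst a)}"

lemma equiv_diag_rel: "equiv UNIV (diag_rel n)"
  by (rule equivI) (auto simp: diag_rel_def refl_on_def sym_def trans_def)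

lemma Pi02_diag_rel: "Pi02 (diag_rel n)"
proof -
  have "total_rec (\<lambda>x. list_encode (block_tuple n x))"
    unfolding block_tuple_def by (intro total_rec_list_encode_map total_rec_basic)
  note tuple = compose[OF this]
  have "sigma1 (splits n)"
    unfolding splits_def
    by (intro sigma1_ex sigma1_conj sigma1_evaluates sigma1_decidable decidable_bounded_ex
        decidable_not decidable_eq total_rec_nth_code total_rec_basic tuple)
  note splits = sigma1_compose[OF this]
  have "pi2 (\<lambda>x. pfst x = psnd x \<or> pfst (pfst x) = pfst (psnd x) \<and> splits n (pfst (pfst x)))"
    by (intro pi2_sigma1 sigma1_disj sigma1_conj splits sigma1_decidable decidable_eq total_rec_basic)
  then show ?thesis
    by (intro Pi02I) (simp add: diag_rel_def split_beta)
qed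

lemma not_creducible_diag_rel:
  assumes "n > 0"
  shows "\<not> creducible_n (n + 1) (diag_rel n) (block_rel n)"
proof
  assume "creducible_n (n + 1) (diag_rel n) (block_rel n)"
  then obtain f where f: "total_rec f" and red: "\<And>xs. length xs = n + 1 \<Longrightarrow>
      length (list_decode (f (list_encode xs))) = n + 1 \<and>
      (\<forall>i j. i < j \<and> j < n + 1 \<longrightarrow> ((xs ! i, xs ! j) \<in> diag_rel n \<longleftrightarrow>
        (list_decode (f (list_encode xs)) ! i, list_decode (f (list_encode xs)) ! j) \<in> block_rel n))"
    unfolding creducible_n_def Let_def by blast
  obtain e where e: "\<And>x. evaluates e x (f x)"
    using total_rec_evaluates[OF f] by blast
  define v where "v = f (list_encode (block_tuple n e))"
  define ys where "ys = list_decode v"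
  have len: "length ys = n + 1"
    and ys: "\<And>i j. i < j \<Longrightarrow> j < n + 1 \<Longrightarrow>
      (block_tuple n e ! i, block_tuple n e ! j) \<in> diag_rel n \<longleftrightarrow> (ys ! i, ys ! j) \<in> block_rel n"
    using red[of "block_tuple n e"] by (auto simp: block_tuple_def v_def ys_def)
  \<comment> \<open>The entries are distinct and share the first component \<open>e\<close>, so all
    pairs get the same answer.\<close>
  have diag: "(block_tuple n e ! i, block_tuple n e ! j) \<in> diag_rel n \<longleftrightarrow> splits n e"
    if "i < j" "j < n + 1" for i j
    using that by (simp add: diag_rel_def block_tuple_def nth_append del: upt_Suc)
  have nth: "nth_code v i = ys ! i" if "i < n + 1" for i
    using nth_code_list_encode[of i ys] that len by (simp add: ys_def)
  have splits: "splits n e \<longleftrightarrow> (\<exists>i<n + 1. pfst (ys ! i) \<noteq> pfst (ys ! 0))"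
    using e[of "list_encode (block_tuple n e)"] evaluates_functional nth
    unfolding splits_def v_def[symmetric] by (metis add_gr_0 zero_less_one)
  show False
  proof (cases "splits n e")
    case True
    then obtain i where i: "i < n + 1" "pfst (ys ! i) \<noteq> pfst (ys ! 0)"
      using splits by blast
    then have "0 < i" by (cases i) auto
    \<comment> \<open>The tuple has been collapsed, so these outputs must be related, yet
      \<open>block_rel\<close> never relates different blocks.\<close>
    with i have "(ys ! 0, ys ! i) \<in> block_rel n"
      using ys diag True by blast
    with i show False by (simp add: block_rel_def)
  next
    case False
    \<comment> \<open>All outputs lie in one block, where \<open>n + 1\<close> of them share
      \<open>n\<close> slots; \<open>n > 0\<close> keeps the default slot 0 among these. Two outputs
      in one slot are related, although the tuple has stayed discrete.\<close>
    have "\<not> inj_on (\<lambda>i. slot n (ys ! i)) {..<n + 1}"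
    proof (rule pigeonhole)
      have "(\<lambda>i. slot n (ys ! i)) ` {..<n + 1} \<subseteq> {..<n}"
        using assms by (auto simp: slot_def)
      from card_mono[OF _ this] show "card ((\<lambda>i. slot n (ys ! i)) ` {..<n + 1}) < card {..<n + 1}"
        by simp
    qed
    then obtain i j where ij: "i < j" "j < n + 1" "slot n (ys ! i) = slot n (ys ! j)"
      unfolding inj_on_def by (metis lessThan_iff nat_neq_iff)
    with False splits have "pfst (ys ! i) = pfst (ys ! j)"
      by (metis less_trans)
    with ij have "(ys ! i, ys ! j) \<in> block_rel n"
      by (simp add: block_rel_def)
    with ij ys diag False show False by blast
  qed
qed

theorem theorem4p8:
  fixes n :: nat
  assumes "n > 1"
  shows "\<exists>E :: (nat \<times> nat) set. equiv UNIV E \<and> Pi02 E \<and>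
           Pi02_complete_n n E \<and> \<not> Pi02_complete_n (n + 1) E"
proof (intro exI conjI)
  show "Pi02_complete_n n (block_rel n)"
    by (simp add: Pi02_complete_n_def Pi02_block_rel creducible_n_block_rel)
  show "\<not> Pi02_complete_n (n + 1) (block_rel n)"
    using not_creducible_diag_rel[of n] equiv_diag_rel Pi02_diag_rel assms
    by (auto simp: Pi02_complete_n_def)
qed (rule equiv_block_rel Pi02_block_rel)+

end
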